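(* Let $F(z)=\frac1n\sum_{i=1}^nH_i(z)$ with $H_i:\mathbb{R}^{d'}\to\mathbb{R}^{d'}$ held by client $i$. Suppose the problem of finding $z_*$ with $\langle F(z_* ),z-z_*\rangle\ge0$ for all $z\in\mathbb{R}^{d'}$ has a unique solution $z_*$; each $H_i$ is $\mu$-quasi-strongly monotone around $z_*$, i.e. $\langle H_i(y)-H_i(z_* ),y-z_*\rangle\ge\mu\|y-z_*\|^2$ for all $y\in\mathbb{R}^{d'}$ ($\mu>0$); and the stochastic operator $g_i(y)$ is an unbiased estimator of $H_i(y)$ satisfying $\mathbb{E}\|g_i(y)-g_i(z_* )\|^2\le L_g\langle H_i(y)-H_i(z_* ),y-z_*\rangle$ for all $y\in\mathbb{R}^{d'}$. Then, for suitable choices of the step size $\gamma$ and the communication probability $p$, ProxSkip-VIP-FL achieves $\mathbb{E}[V_K]\le\epsilon$ with iteration complexity $$\mathcal O\left(\max\left\{\frac{L_g}\mu,\frac{\sigma_*^2}{\mu^2\epsilon}\right\}\ln\frac1\epsilon\right)$$ and communication complexity $$\mathcal O\left(\sqrt{\max\left\{\frac{L_g}\mu,\frac{\sigma_*^2}{\mu^2\epsilon}\right\}}\,\ln\frac1\epsilon\right).$$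
   Context: ProxSkip-VIP-FL: given $x_{i,0},h_{i,0}\in\mathbb{R}^{d'}$ ($i=1,\dots,n$), $\gamma>0$, $p\in(0,1]$. For $k=0,1,\dots$: flip a coin $\theta_k$ with $\mathbb{P}(\theta_k=1)=p$ (common to all clients, independent of everything else); each client $i$ computes $\widehat x_{i,k+1}=x_{i,k}-\gamma(g_{i,k}-h_{i,k})$ with $g_{i,k}=g_i(x_{i,k})$ (fresh randomness each iteration); if $\theta_k=1$ (a communication round) every client gets $x_{i,k+1}=\frac1n\sum_{j=1}^n\left(\widehat x_{j,k+1}-\frac\gamma ph_{j,k}\right)$, otherwise $x_{i,k+1}=\widehat x_{i,k+1}$; then $h_{i,k+1}=h_{i,k}+\frac p\gamma(x_{i,k+1}-\widehat x_{i,k+1})$. Notation: $V_k=\sum_{i=1}^n\|x_{i,k}-z_*\|^2+\frac{\gamma^2}{p^2}\sum_{i=1}^n\|h_{i,k}-H_i(z_* )\|^2$ and $\sigma_*^2=\sum_{i=1}^n\mathbb{E}\|g_i(z_* )-H_i(z_* )\|^2<\infty$. Iteration complexity is the number $K$ of iterations sufficient for $\mathbb{E}[V_K]\le\epsilon$; communication complexity is the corresponding expected number $pK$ of rounds with $\theta_k=1$. $\mathcal O(\cdot)$ hides absolute numerical constants, and the dependence on $V_0$ inside the logarithm ($\ln\frac1\epsilon$ stands for $\ln\frac{2V_0}\epsilon$). *)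

theory Defs
  imports "HOL-Probability.Probability"
begin

definition mean_operator :: "nat \<Rightarrow> (nat \<Rightarrow> real ^ 'd \<Rightarrow> real ^ 'd) \<Rightarrow> real ^ 'd \<Rightarrow> real ^ 'd" where
  "mean_operator n H z = (1 / real n) *\<^sub>R (\<Sum>i=1..n. H i z)"

definition VI_solution :: "(real ^ 'd \<Rightarrow> real ^ 'd) \<Rightarrow> real ^ 'd \<Rightarrow> bool" where
  "VI_solution F zs \<longleftrightarrow> (\<forall>z. F zs \<bullet> (z - zs) \<ge> 0)"

definition quasi_strongly_monotone ::
    "(real ^ 'd \<Rightarrow> real ^ 'd) \<Rightarrow> real ^ 'd \<Rightarrow> real \<Rightarrow> bool" where
  "quasi_strongly_monotone H zs \<mu> \<longleftrightarrow> (\<forall>y. (H y - H zs) \<bullet> (y - zs) \<ge> \<mu> * (norm (y - zs))\<^sup>2)"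

text \<open>
  A stochastic operator is a function \<open>g\<close> of a point and a sample \<open>s\<close> drawn from \<open>D\<close>. Joint
  measurability in (point, sample) is what makes the evaluation of \<open>g\<close> at a random point a random
  variable.
\<close>

definition stochastic_operator ::
    "'s measure \<Rightarrow> (real ^ 'd \<Rightarrow> 's \<Rightarrow> real ^ 'd) \<Rightarrow> bool" where
  "stochastic_operator D g \<longleftrightarrow> case_prod g \<in> borel_measurable (borel \<Otimes>\<^sub>M D)"

definition unbiased_estimator ::
    "'s measure \<Rightarrow> (real ^ 'd \<Rightarrow> 's \<Rightarrow> real ^ 'd) \<Rightarrow> (real ^ 'd \<Rightarrow> real ^ 'd) \<Rightarrow> bool" where
  "unbiased_estimator D g H \<longleftrightarrow> (\<forall>y. integrable D (g y) \<and> (\<integral>s. g y s \<partial>D) = H y)"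

text \<open>
  Integrability is required explicitly, here and below, because the integral of a non-integrable
  function is \<open>0\<close> by convention.
\<close>

definition expected_cocoercive ::
    "'s measure \<Rightarrow> (real ^ 'd \<Rightarrow> 's \<Rightarrow> real ^ 'd) \<Rightarrow> (real ^ 'd \<Rightarrow> real ^ 'd) \<Rightarrow> real ^ 'd \<Rightarrow> real \<Rightarrow> bool"
  where
  "expected_cocoercive D g H zs L \<longleftrightarrow>
     (\<forall>y. integrable D (\<lambda>s. (norm (g y s - g zs s))\<^sup>2) \<and>
          (\<integral>s. (norm (g y s - g zs s))\<^sup>2 \<partial>D) \<le> L * ((H y - H zs) \<bullet> (y - zs)))"

definition finite_noise ::
    "'s measure \<Rightarrow> (real ^ 'd \<Rightarrow> 's \<Rightarrow> real ^ 'd) \<Rightarrow> (real ^ 'd \<Rightarrow> real ^ 'd) \<Rightarrow> real ^ 'd \<Rightarrow> bool" where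
  "finite_noise D g H zs \<longleftrightarrow> integrable D (\<lambda>s. (norm (g zs s - H zs))\<^sup>2)"

definition noise_var ::
    "nat \<Rightarrow> 's measure \<Rightarrow> (nat \<Rightarrow> real ^ 'd \<Rightarrow> 's \<Rightarrow> real ^ 'd) \<Rightarrow> (nat \<Rightarrow> real ^ 'd \<Rightarrow> real ^ 'd)
      \<Rightarrow> real ^ 'd \<Rightarrow> real" where
  "noise_var n D g H zs = (\<Sum>i=1..n. \<integral>s. (norm (g i zs s - H i zs))\<^sup>2 \<partial>D)"

text \<open>
  The state is the pair of families \<open>(x\<^sub>i, h\<^sub>i)\<close>. \<open>\<theta> k\<close> is the outcome of the common coin and \<open>\<xi> k\<close>
  the sample of iteration \<open>k\<close>. The single sample \<open>\<xi> k\<close> carries the randomness of all clients, each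
  \<open>g i\<close> reading the part that concerns it; independent clients are the case of a product measure.
\<close>

primrec proxskip_vip_fl ::
    "nat \<Rightarrow> real \<Rightarrow> real \<Rightarrow> (nat \<Rightarrow> real ^ 'd \<Rightarrow> 's \<Rightarrow> real ^ 'd)
      \<Rightarrow> (nat \<Rightarrow> real ^ 'd) \<Rightarrow> (nat \<Rightarrow> real ^ 'd) \<Rightarrow> (nat \<Rightarrow> bool) \<Rightarrow> (nat \<Rightarrow> 's)
      \<Rightarrow> nat \<Rightarrow> (nat \<Rightarrow> real ^ 'd) \<times> (nat \<Rightarrow> real ^ 'd)" where
  "proxskip_vip_fl n \<gamma> p g x0 h0 \<theta> \<xi> 0 = (x0, h0)"
| "proxskip_vip_fl n \<gamma> p g x0 h0 \<theta> \<xi> (Suc k) =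
    (let (x, h) = proxskip_vip_fl n \<gamma> p g x0 h0 \<theta> \<xi> k;
         xhat = (\<lambda>i. x i - \<gamma> *\<^sub>R (g i (x i) (\<xi> k) - h i));
         x' = (\<lambda>i. if \<theta> k then (1 / real n) *\<^sub>R (\<Sum>j=1..n. xhat j - (\<gamma> / p) *\<^sub>R h j) else xhat i);
         h' = (\<lambda>i. h i + (p / \<gamma>) *\<^sub>R (x' i - xhat i))
     in (x', h'))"

definition lyapunov ::
    "nat \<Rightarrow> real \<Rightarrow> real \<Rightarrow> (nat \<Rightarrow> real ^ 'd \<Rightarrow> real ^ 'd) \<Rightarrow> real ^ 'd
      \<Rightarrow> (nat \<Rightarrow> real ^ 'd) \<times> (nat \<Rightarrow> real ^ 'd) \<Rightarrow> real" where
  "lyapunov n \<gamma> p H zs = (\<lambda>(x, h). (\<Sum>i=1..n. (norm (x i - zs))\<^sup>2)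
     + \<gamma>\<^sup>2 / p\<^sup>2 * (\<Sum>i=1..n. (norm (h i - H i zs))\<^sup>2))"

definition comm_rounds :: "(nat \<Rightarrow> bool) \<Rightarrow> nat \<Rightarrow> nat" where
  "comm_rounds \<theta> K = card {k. k < K \<and> \<theta> k}"

text \<open>
  The pairs \<open>(\<theta> k, \<xi> k)\<close> are independent across iterations, and each has law
  Bernoulli(\<open>p\<close>) \<open>\<otimes>\<close> \<open>D\<close>; the product law is the independence of coin and sample within an
  iteration, so all the variables \<open>\<theta> k\<close>, \<open>\<xi> k\<close> are mutually independent.
\<close>

definition proxskip_randomness ::
    "'w measure \<Rightarrow> real \<Rightarrow> 's measure \<Rightarrow> (nat \<Rightarrow> 'w \<Rightarrow> bool) \<Rightarrow> (nat \<Rightarrow> 'w \<Rightarrow> 's) \<Rightarrow> bool" where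
  "proxskip_randomness M p D \<theta> \<xi> \<longleftrightarrow>
     prob_space M \<and>
     prob_space.indep_vars M (\<lambda>_. count_space UNIV \<Otimes>\<^sub>M D) (\<lambda>k \<omega>. (\<theta> k \<omega>, \<xi> k \<omega>)) UNIV \<and>
     (\<forall>k. distr M (count_space UNIV \<Otimes>\<^sub>M D) (\<lambda>\<omega>. (\<theta> k \<omega>, \<xi> k \<omega>))
            = measure_pmf (bernoulli_pmf p) \<Otimes>\<^sub>M D)"

text \<open>
  The constant hidden in \<open>\<O>(\<cdot>)\<close>. It has to be absolute, in particular independent of the dimension
  and of the sample spaces. These are types here, so a constant quantified existentially inside a
  theorem would be allowed to depend on them; hence a numeral.
\<close>

definition abs_const :: real where
  "abs_const = 8"

text \<open>
  The factor \<open>ln (2 V\<^sub>0 / \<epsilon>)\<close>, cut off at \<open>0\<close>: an initial point with \<open>2 V\<^sub>0 < \<epsilon>\<close> needs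
  no iterations, rather than a negative number of them.
\<close>

definition log_factor :: "real \<Rightarrow> real \<Rightarrow> real" where
  "log_factor V0 \<epsilon> = max 0 (ln (2 * V0 / \<epsilon>))"

end

theory Submission
  imports Defs
begin

text \<open>
  Write \<open>z\<close> for the solution; on the whole space the variational inequality says
  \<open>F(z) = 0\<close>, that is, \<open>\<Sum> H\<^sub>i(z) = 0\<close>. A communication round replaces the vectors
  \<open>y\<^sub>i = xhat\<^sub>i - (\<gamma>/p) h\<^sub>i\<close> by their mean and stores the deviations from the mean in the new
  \<open>h\<^sub>i\<close>. The optimal point \<open>y*\<^sub>i = z - (\<gamma>/p) H\<^sub>i(z)\<close> has mean \<open>z\<close> and deviations proportional to
  \<open>H\<^sub>i(z)\<close>, so Pythagoras (\<open>sum_norm_sq_mean\<close>) says that after such a round the Lyapunov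
  function is exactly \<open>\<Sum> \<parallel>y\<^sub>i - y*\<^sub>i\<parallel>\<^sup>2\<close>. Averaging over the coin gives the identity
  (\<open>lyapunov_step_average\<close>)
  \<open>E V' = \<Sum> \<parallel>x\<^sub>i - z - \<gamma>(g\<^sub>i - H\<^sub>i(z))\<parallel>\<^sup>2 + (1 - p\<^sup>2) (\<gamma>\<^sup>2/p\<^sup>2) \<Sum> \<parallel>h\<^sub>i - H\<^sub>i(z)\<parallel>\<^sup>2\<close>:
  the control variates contract by \<open>1 - p\<^sup>2\<close>, and the \<open>h\<^sub>i\<close> have disappeared from the first
  sum, whose terms are plain stochastic operator steps. Those contract by \<open>1 - \<gamma>\<mu>\<close> up to
  \<open>2 \<gamma>\<^sup>2 \<sigma>\<^sup>2\<close> as soon as \<open>\<gamma> L \<le> 1/2\<close> (\<open>operator_step_contraction\<close>).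

  The choice \<open>p = \<surd>(\<gamma>\<mu>)\<close> makes both rates equal. It is what saves communication: the
  \<open>1/(\<gamma>\<mu>)\<close> iterations that reduce the error by a constant factor contain on average only
  \<open>1/\<surd>(\<gamma>\<mu>)\<close> communication rounds. Iterating gives
  \<open>E V\<^sub>k \<le> (1 - p\<^sup>2)\<^sup>k V\<^sub>0 + (1 - (1 - p\<^sup>2)\<^sup>k) 2\<gamma>\<sigma>\<^sup>2/\<mu>\<close> (\<open>expected_V\<close>).

  With \<open>m = max (L/\<mu>) (\<sigma>\<^sup>2/(\<mu>\<^sup>2\<epsilon>))\<close> and \<open>\<gamma> = 1/(4\<mu>m)\<close> the step size condition holds, the noise
  term is at most \<open>\<epsilon>/2\<close>, and the rate is \<open>p\<^sup>2 = 1/(4m)\<close>; hence about \<open>4 m ln (2V\<^sub>0/\<epsilon>)\<close>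
  iterations bring the other term below \<open>\<epsilon>/2\<close>, and they cost \<open>2 \<surd>m ln (2V\<^sub>0/\<epsilon>)\<close> expected
  rounds. That \<open>p \<le> 1\<close> follows from \<open>\<mu> \<le> L\<close>
  (\<open>strong_monotonicity_le_cocoercivity\<close>). Doubling the number of iterations pays for
  rounding it down to an integer (\<open>geometric_decay_after_log_iterations\<close>).
\<close>

section \<open>One iteration as a deterministic map\<close>

lemma sum_norm_sq_mean:
  fixes u :: "'i \<Rightarrow> 'a::real_inner"
  assumes "finite I" "I \<noteq> {}"
  defines "m \<equiv> (1 / real (card I)) *\<^sub>R (\<Sum>i\<in>I. u i)"
  shows "(\<Sum>i\<in>I. (norm m)\<^sup>2) + (\<Sum>i\<in>I. (norm (m - u i))\<^sup>2) = (\<Sum>i\<in>I. (norm (u i))\<^sup>2)"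
proof -
  have sum_u: "(\<Sum>i\<in>I. u i) = real (card I) *\<^sub>R m"
    using assms by (simp add: m_def)
  have "(\<Sum>i\<in>I. (norm (m - u i))\<^sup>2)
      = (\<Sum>i\<in>I. (norm m)\<^sup>2) - 2 * (m \<bullet> (\<Sum>i\<in>I. u i)) + (\<Sum>i\<in>I. (norm (u i))\<^sup>2)"
    by (simp add: power2_norm_eq_inner inner_diff_left inner_diff_right inner_commute
        sum.distrib sum_subtractf inner_sum_right sum_distrib_left algebra_simps)
  then show ?thesis
    by (simp add: sum_u power2_norm_eq_inner)
qed

text \<open>
  One iteration with the sampled operator values \<open>G\<close> and the coin \<open>b\<close> as arguments, so that the
  algebra of the method can be separated from its randomness.
\<close>

definition fl_step ::
    "nat \<Rightarrow> real \<Rightarrow> real \<Rightarrow> (nat \<Rightarrow> real ^ 'd) \<Rightarrow> bool \<Rightarrow> (nat \<Rightarrow> real ^ 'd) \<times> (nat \<Rightarrow> real ^ 'd)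
      \<Rightarrow> (nat \<Rightarrow> real ^ 'd) \<times> (nat \<Rightarrow> real ^ 'd)" where
  "fl_step n \<gamma> p G b = (\<lambda>(x, h).
     let xhat = (\<lambda>i. x i - \<gamma> *\<^sub>R (G i - h i));
         x' = (\<lambda>i. if b then (1 / real n) *\<^sub>R (\<Sum>j=1..n. xhat j - (\<gamma> / p) *\<^sub>R h j) else xhat i);
         h' = (\<lambda>i. h i + (p / \<gamma>) *\<^sub>R (x' i - xhat i))
     in (x', h'))"

lemma proxskip_vip_fl_Suc_step:
  "proxskip_vip_fl n \<gamma> p g x0 h0 \<theta> \<xi> (Suc k) =
     fl_step n \<gamma> p (\<lambda>i. g i (fst (proxskip_vip_fl n \<gamma> p g x0 h0 \<theta> \<xi> k) i) (\<xi> k)) (\<theta> k)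
       (proxskip_vip_fl n \<gamma> p g x0 h0 \<theta> \<xi> k)"
  by (cases "proxskip_vip_fl n \<gamma> p g x0 h0 \<theta> \<xi> k") (simp add: fl_step_def Let_def)

\<comment> \<open>Runs are unfolded through \<open>fl_step\<close> only.\<close>
declare proxskip_vip_fl.simps(2) [simp del]

lemma convex_combination_norm_sq:
  fixes a b :: "'a::real_inner"
  shows "p * (norm (a - b))\<^sup>2 + (1 - p) * ((norm a)\<^sup>2 + (norm b)\<^sup>2)
    = (norm (a - p *\<^sub>R b))\<^sup>2 + (1 - p\<^sup>2) * (norm b)\<^sup>2"
  unfolding power2_norm_eq_inner
  by (simp add: inner_diff_left inner_diff_right inner_commute power2_eq_square algebra_simps)

lemma lyapunov_nonneg: "lyapunov n \<gamma> p H zs s \<ge> 0"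
  unfolding lyapunov_def split_beta
  by (intro add_nonneg_nonneg mult_nonneg_nonneg sum_nonneg divide_nonneg_nonneg zero_le_power2)

text \<open>
  In the proof, \<open>a i\<close> and \<open>b i\<close> are the errors of \<open>xhat\<^sub>i\<close> and of \<open>(\<gamma>/p) h\<^sub>i\<close>. Without
  communication the Lyapunov function is \<open>\<Sum> \<parallel>a\<parallel>\<^sup>2 + \<parallel>b\<parallel>\<^sup>2\<close>; with communication it is
  \<open>\<Sum> \<parallel>a - b\<parallel>\<^sup>2\<close>, because the new \<open>x\<close>-error is the mean of the vectors \<open>a - b\<close> (the \<open>H\<^sub>i(z)\<close> sum
  to \<open>0\<close>) and the new \<open>h\<close>-errors are, up to scaling, their deviations from that mean. The convex
  combination of the two completes to the square of \<open>a - p b\<close>, from which \<open>h\<close> cancels.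
\<close>

lemma lyapunov_step_average:
  fixes x h G :: "nat \<Rightarrow> real ^ 'd"
  assumes n: "n \<ge> 1" and \<gamma>: "\<gamma> > 0" and p: "p > 0" and zero: "(\<Sum>i=1..n. H i zs) = 0"
  shows "p * lyapunov n \<gamma> p H zs (fl_step n \<gamma> p G True (x, h))
      + (1 - p) * lyapunov n \<gamma> p H zs (fl_step n \<gamma> p G False (x, h))
    = (\<Sum>i=1..n. (norm (x i - zs - \<gamma> *\<^sub>R (G i - H i zs)))\<^sup>2)
      + (1 - p\<^sup>2) * (\<gamma>\<^sup>2 / p\<^sup>2 * (\<Sum>i=1..n. (norm (h i - H i zs))\<^sup>2))"
proof -
  define a where "a i = x i - \<gamma> *\<^sub>R (G i - h i) - zs" for i
  define b where "b i = (\<gamma> / p) *\<^sub>R (h i - H i zs)" for i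
  define m where "m = (1 / real n) *\<^sub>R (\<Sum>i=1..n. a i - b i)"
  have sum_b: "(\<Sum>i=1..n. b i) = (\<Sum>i=1..n. (\<gamma> / p) *\<^sub>R h i)"
    using zero by (simp add: b_def sum_subtractf flip: scaleR_right.sum)
  have m_eq: "(1 / real n) *\<^sub>R (\<Sum>j=1..n. x j - \<gamma> *\<^sub>R (G j - h j) - (\<gamma> / p) *\<^sub>R h j) = m + zs"
  proof -
    have "(\<Sum>j=1..n. x j - \<gamma> *\<^sub>R (G j - h j) - (\<gamma> / p) *\<^sub>R h j)
        = (\<Sum>j=1..n. a j + zs) - (\<Sum>j=1..n. b j)"
      unfolding sum_b by (simp add: a_def sum_subtractf)
    also have "\<dots> = (\<Sum>j=1..n. a j - b j) + real n *\<^sub>R zs"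
      by (simp add: sum.distrib sum_subtractf scaleR_conv_of_real sum_constant_scaleR)
    finally show ?thesis
      using n by (simp add: m_def scaleR_add_right)
  qed
  have h_True: "h i + (p / \<gamma>) *\<^sub>R (m + zs - (x i - \<gamma> *\<^sub>R (G i - h i))) - H i zs
      = (p / \<gamma>) *\<^sub>R (m - (a i - b i))" for i
    using \<gamma> p by (simp add: a_def b_def algebra_simps)
  have "lyapunov n \<gamma> p H zs (fl_step n \<gamma> p G True (x, h))
      = (\<Sum>i=1..n. (norm m)\<^sup>2) + (\<Sum>i=1..n. (norm (m - (a i - b i)))\<^sup>2)"
    using \<gamma> p
    by (simp add: fl_step_def lyapunov_def m_eq h_True power_mult_distrib power_divide
        sum_distrib_left del: One_nat_def)
  also have "\<dots> = (\<Sum>i=1..n. (norm (a i - b i))\<^sup>2)"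
    using sum_norm_sq_mean[of "{1..n}" "\<lambda>i. a i - b i"] n by (simp add: m_def)
  finally have T: "lyapunov n \<gamma> p H zs (fl_step n \<gamma> p G True (x, h))
      = (\<Sum>i=1..n. (norm (a i - b i))\<^sup>2)" .
  have norm_b: "(\<Sum>i=1..n. (norm (b i))\<^sup>2) = \<gamma>\<^sup>2 / p\<^sup>2 * (\<Sum>i=1..n. (norm (h i - H i zs))\<^sup>2)"
    by (simp add: b_def power_mult_distrib power_divide sum_distrib_left)
  have F: "lyapunov n \<gamma> p H zs (fl_step n \<gamma> p G False (x, h))
      = (\<Sum>i=1..n. (norm (a i))\<^sup>2 + (norm (b i))\<^sup>2)"
    unfolding sum.distrib norm_b by (simp add: fl_step_def lyapunov_def a_def)
  have ab: "a i - p *\<^sub>R b i = x i - zs - \<gamma> *\<^sub>R (G i - H i zs)" for i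
    using p by (simp add: a_def b_def algebra_simps)
  have "p * lyapunov n \<gamma> p H zs (fl_step n \<gamma> p G True (x, h))
      + (1 - p) * lyapunov n \<gamma> p H zs (fl_step n \<gamma> p G False (x, h))
    = (\<Sum>i=1..n. p * (norm (a i - b i))\<^sup>2 + (1 - p) * ((norm (a i))\<^sup>2 + (norm (b i))\<^sup>2))"
    unfolding T F by (simp only: sum.distrib sum_distrib_left distrib_left)
  also have "\<dots> = (\<Sum>i=1..n. (norm (a i - p *\<^sub>R b i))\<^sup>2) + (1 - p\<^sup>2) * (\<Sum>i=1..n. (norm (b i))\<^sup>2)"
    by (simp add: convex_combination_norm_sq sum.distrib sum_distrib_left)
  finally show ?thesis
    unfolding ab norm_b .
qed

section \<open>One stochastic operator step\<close>

text \<open>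
  Expanding the square produces \<open>-2\<gamma>c\<close> with \<open>c = (H y - H zs) \<bullet> (y - zs)\<close>. The second
  moment of \<open>g y - H zs\<close> is split at \<open>g zs\<close>, and cocoercivity bounds it by \<open>2Lc\<close> plus twice the
  noise; for \<open>\<gamma> L \<le> 1/2\<close> this uses up at most half of the descent, and the other half, \<open>-\<gamma>c\<close>,
  gives the contraction by strong monotonicity.
\<close>

lemma operator_step_contraction:
  fixes g :: "real ^ 'd \<Rightarrow> 's \<Rightarrow> real ^ 'd"
  assumes D: "prob_space D" and unb: "unbiased_estimator D g H"
    and coc: "expected_cocoercive D g H zs L" and noise: "finite_noise D g H zs"
    and qsm: "quasi_strongly_monotone H zs \<mu>"
    and \<gamma>: "\<gamma> > 0" "\<gamma> * L \<le> 1 / 2" and \<mu>: "\<mu> > 0"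
  shows "integrable D (\<lambda>s. (norm (y - zs - \<gamma> *\<^sub>R (g y s - H zs)))\<^sup>2)" (is ?int)
    and "(\<integral>s. (norm (y - zs - \<gamma> *\<^sub>R (g y s - H zs)))\<^sup>2 \<partial>D)
      \<le> (1 - \<gamma> * \<mu>) * (norm (y - zs))\<^sup>2 + 2 * \<gamma>\<^sup>2 * (\<integral>s. (norm (g zs s - H zs))\<^sup>2 \<partial>D)" (is ?le)
proof -
  interpret prob_space D by (rule D)
  let ?c = "(H y - H zs) \<bullet> (y - zs)"
  let ?\<sigma> = "\<integral>s. (norm (g zs s - H zs))\<^sup>2 \<partial>D"
  have ig [simp]: "integrable D (g y)" for y
    using unb by (simp add: unbiased_estimator_def)
  have Eg: "(\<integral>s. g y s \<partial>D) = H y" for y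
    using unb by (simp add: unbiased_estimator_def)
  have i1: "integrable D (\<lambda>s. (norm (g y s - g zs s))\<^sup>2)"
    and E1: "(\<integral>s. (norm (g y s - g zs s))\<^sup>2 \<partial>D) \<le> L * ?c"
    using coc by (auto simp: expected_cocoercive_def)
  have i2: "integrable D (\<lambda>s. (norm (g zs s - H zs))\<^sup>2)"
    using noise by (simp add: finite_noise_def)
  have split: "(norm (g y s - H zs))\<^sup>2
      \<le> 2 * (norm (g y s - g zs s))\<^sup>2 + 2 * (norm (g zs s - H zs))\<^sup>2" for s
  proof -
    have "norm (g y s - H zs) \<le> norm (g y s - g zs s) + norm (g zs s - H zs)"
      by (metis norm_triangle_ineq diff_add_cancel add_diff_eq)
    then have "(norm (g y s - H zs))\<^sup>2 \<le> (norm (g y s - g zs s) + norm (g zs s - H zs))\<^sup>2"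
      by (simp add: power_mono)
    also have "\<dots> \<le> 2 * (norm (g y s - g zs s))\<^sup>2 + 2 * (norm (g zs s - H zs))\<^sup>2"
      using sum_squares_bound[of "norm (g y s - g zs s)" "norm (g zs s - H zs)"]
      by (simp add: power2_sum)
    finally show ?thesis .
  qed
  have i3: "integrable D (\<lambda>s. (norm (g y s - H zs))\<^sup>2)"
  proof (rule Bochner_Integration.integrable_bound)
    show "integrable D (\<lambda>s. 2 * (norm (g y s - g zs s))\<^sup>2 + 2 * (norm (g zs s - H zs))\<^sup>2)"
      using i1 i2 by simp
    show "(\<lambda>s. (norm (g y s - H zs))\<^sup>2) \<in> borel_measurable D"
      using borel_measurable_integrable[OF ig[of y]] by simp
  qed (use split in \<open>simp add: add_nonneg_nonneg\<close>)
  have E3: "(\<integral>s. (norm (g y s - H zs))\<^sup>2 \<partial>D) \<le> 2 * L * ?c + 2 * ?\<sigma>"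
  proof -
    have "(\<integral>s. (norm (g y s - H zs))\<^sup>2 \<partial>D)
        \<le> (\<integral>s. 2 * (norm (g y s - g zs s))\<^sup>2 + 2 * (norm (g zs s - H zs))\<^sup>2 \<partial>D)"
      using i1 i2 i3 split by (intro integral_mono) auto
    also have "\<dots> \<le> 2 * L * ?c + 2 * ?\<sigma>"
      using i1 i2 E1 by simp
    finally show ?thesis .
  qed
  define u where "u s = (g y s - H zs) \<bullet> (y - zs)" for s
  have u_int: "integrable D u"
    unfolding u_def by (intro integrable_inner_left) simp
  have "(\<integral>s. u s \<partial>D) = (\<integral>s. g y s - H zs \<partial>D) \<bullet> (y - zs)"
    unfolding u_def by (intro integral_inner_left) simp
  also have "(\<integral>s. g y s - H zs \<partial>D) = H y - H zs"
    by (simp add: Eg prob_space)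
  finally have Eu: "(\<integral>s. u s \<partial>D) = ?c" .
  have expand: "(norm (y - zs - \<gamma> *\<^sub>R (g y s - H zs)))\<^sup>2
      = (norm (y - zs))\<^sup>2 - 2 * \<gamma> * u s + \<gamma>\<^sup>2 * (norm (g y s - H zs))\<^sup>2" for s
    unfolding power2_norm_eq_inner u_def
    by (simp only: inner_diff_left[of "y - zs"] inner_diff_right[of _ "y - zs"] inner_scaleR_left
        inner_scaleR_right inner_commute[of "y - zs" "g y s - H zs"] power2_eq_square)
      (simp only: algebra_simps)
  show ?int
    unfolding expand using i3 u_int by simp
  have "(\<integral>s. (norm (y - zs - \<gamma> *\<^sub>R (g y s - H zs)))\<^sup>2 \<partial>D)
      = (norm (y - zs))\<^sup>2 - 2 * \<gamma> * ?c + \<gamma>\<^sup>2 * (\<integral>s. (norm (g y s - H zs))\<^sup>2 \<partial>D)"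
    unfolding expand using i3 u_int by (simp add: Eu prob_space)
  also have "\<dots> \<le> (norm (y - zs))\<^sup>2 - 2 * \<gamma> * ?c + \<gamma>\<^sup>2 * (2 * L * ?c + 2 * ?\<sigma>)"
    using E3 by (intro add_left_mono mult_left_mono) auto
  also have "\<dots> = (norm (y - zs))\<^sup>2 - 2 * (1 - \<gamma> * L) * (\<gamma> * ?c) + 2 * \<gamma>\<^sup>2 * ?\<sigma>"
    by (simp add: algebra_simps power2_eq_square)
  also have "\<dots> \<le> (norm (y - zs))\<^sup>2 - 1 * (\<gamma> * (\<mu> * (norm (y - zs))\<^sup>2)) + 2 * \<gamma>\<^sup>2 * ?\<sigma>"
  proof -
    have "1 * (\<gamma> * (\<mu> * (norm (y - zs))\<^sup>2)) \<le> 2 * (1 - \<gamma> * L) * (\<gamma> * ?c)"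
      using qsm \<gamma> \<mu> by (intro mult_mono mult_left_mono) (auto simp: quasi_strongly_monotone_def)
    then show ?thesis by simp
  qed
  finally show ?le
    by (simp add: algebra_simps)
qed

text \<open>
  Tested at \<open>zs + e\<close> with a unit vector \<open>e\<close>: by Jensen's inequality (the variance of
  \<open>(g y - g zs) \<bullet> e\<close> is nonnegative) the number \<open>t = (H y - H zs) \<bullet> e\<close> satisfies \<open>t\<^sup>2 \<le> L t\<close>,
  and strong monotonicity gives \<open>t \<ge> \<mu> > 0\<close>.
\<close>

lemma strong_monotonicity_le_cocoercivity:
  fixes g :: "real ^ 'd \<Rightarrow> 's \<Rightarrow> real ^ 'd"
  assumes D: "prob_space D" and unb: "unbiased_estimator D g H"
    and coc: "expected_cocoercive D g H zs L"
    and qsm: "quasi_strongly_monotone H zs \<mu>" and \<mu>: "\<mu> > 0"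
  shows "\<mu> \<le> L"
proof -
  interpret prob_space D by (rule D)
  obtain e :: "real ^ 'd" where e: "norm e = 1"
    using vector_choose_size[of 1] by auto
  define y where "y = zs + e"
  define w where "w = H y - H zs"
  have y: "y - zs = e" by (simp add: y_def)
  have mono: "\<mu> \<le> w \<bullet> e"
    using qsm[unfolded quasi_strongly_monotone_def, rule_format, of y] by (simp add: y e w_def)
  have ig: "integrable D (g y)" "integrable D (g zs)"
    and Eg: "(\<integral>s. g y s \<partial>D) = H y" "(\<integral>s. g zs s \<partial>D) = H zs"
    using unb by (auto simp: unbiased_estimator_def)
  define f where "f s = (g y s - g zs s) \<bullet> e" for s
  have i_f: "integrable D f"
    unfolding f_def using ig by (intro integrable_inner_left) auto
  have f_le: "(f s)\<^sup>2 \<le> (norm (g y s - g zs s))\<^sup>2" for s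
    using Cauchy_Schwarz_ineq2[of "g y s - g zs s" e] unfolding f_def
    by (simp add: e abs_le_square_iff[symmetric])
  have i_norm: "integrable D (\<lambda>s. (norm (g y s - g zs s))\<^sup>2)"
    and E_norm: "(\<integral>s. (norm (g y s - g zs s))\<^sup>2 \<partial>D) \<le> L * (w \<bullet> e)"
    using coc unfolding expected_cocoercive_def w_def by (auto simp: y dest: spec[of _ y])
  have i_f2: "integrable D (\<lambda>s. (f s)\<^sup>2)"
    by (rule Bochner_Integration.integrable_bound[OF i_norm])
      (use i_f f_le in \<open>auto intro!: AE_I2\<close>)
  have Ef: "expectation f = w \<bullet> e"
    unfolding f_def using ig by (simp add: integral_inner_left Eg w_def)
  have "0 \<le> variance f"
    by simp
  also have "\<dots> = expectation (\<lambda>s. (f s)\<^sup>2) - (expectation f)\<^sup>2"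
    by (rule variance_eq[OF i_f i_f2])
  finally have "(w \<bullet> e)\<^sup>2 \<le> expectation (\<lambda>s. (f s)\<^sup>2)"
    unfolding Ef by simp
  also have "\<dots> \<le> (\<integral>s. (norm (g y s - g zs s))\<^sup>2 \<partial>D)"
    by (rule integral_mono[OF i_f2 i_norm]) (rule f_le)
  also have "\<dots> \<le> L * (w \<bullet> e)"
    by (rule E_norm)
  finally have "w \<bullet> e \<le> L"
    using mono \<mu> by (simp add: power2_eq_square)
  with mono show ?thesis by simp
qed

lemma proxskip_vip_fl_cong:
  assumes "\<And>j. j < k \<Longrightarrow> \<theta> j = \<theta>' j" and "\<And>j. j < k \<Longrightarrow> \<xi> j = \<xi>' j"
  shows "proxskip_vip_fl n \<gamma> p g x0 h0 \<theta> \<xi> k = proxskip_vip_fl n \<gamma> p g x0 h0 \<theta>' \<xi>' k"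
  using assms by (induction k) (simp_all add: proxskip_vip_fl_Suc_step)

section \<open>Expected decrease along a run\<close>

text \<open>
  The problem together with step parameters for which both contraction rates of the method,
  \<open>\<gamma> \<mu>\<close> for the iterates and \<open>p\<^sup>2\<close> for the control variates, agree.
\<close>

locale proxskip_setting = prob_space D
  for D :: "'s measure" +
  fixes n :: nat
    and H :: "nat \<Rightarrow> real ^ 'd \<Rightarrow> real ^ 'd"
    and g :: "nat \<Rightarrow> real ^ 'd \<Rightarrow> 's \<Rightarrow> real ^ 'd"
    and zs :: "real ^ 'd"
    and \<mu> L \<gamma> p :: real
  assumes n: "n \<ge> 1"
    and zero: "(\<Sum>i=1..n. H i zs) = 0"
    and \<mu>: "\<mu> > 0"
    and monotone: "\<And>i. i \<in> {1..n} \<Longrightarrow> quasi_strongly_monotone (H i) zs \<mu>"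
    and stochastic: "\<And>i. i \<in> {1..n} \<Longrightarrow> stochastic_operator D (g i)"
    and unbiased: "\<And>i. i \<in> {1..n} \<Longrightarrow> unbiased_estimator D (g i) (H i)"
    and cocoercive: "\<And>i. i \<in> {1..n} \<Longrightarrow> expected_cocoercive D (g i) (H i) zs L"
    and noise: "\<And>i. i \<in> {1..n} \<Longrightarrow> finite_noise D (g i) (H i) zs"
    and \<gamma>: "\<gamma> > 0" "\<gamma> * L \<le> 1 / 2"
    and p: "0 < p" "p \<le> 1"
    and p_sq: "p\<^sup>2 = \<gamma> * \<mu>"
begin

abbreviation V where "V \<equiv> lyapunov n \<gamma> p H zs"

abbreviation Q where "Q \<equiv> measure_pmf (bernoulli_pmf p) \<Otimes>\<^sub>M D"

text \<open>
  The state after \<open>k\<close> iterations as a function of the sequence of (coin, sample) pairs. This places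
  the randomness on a product space, where the independence of an iteration from the past is
  Fubini's theorem and no conditional expectation is needed.
\<close>

definition run where
  "run x0 h0 k w = proxskip_vip_fl n \<gamma> p g x0 h0 (\<lambda>j. fst (w j)) (\<lambda>j. snd (w j)) k"

lemma measurable_operator:
  assumes "i \<in> {1..n}" "f \<in> borel_measurable N" "s \<in> N \<rightarrow>\<^sub>M D"
  shows "(\<lambda>w. g i (f w) (s w)) \<in> borel_measurable N"
proof -
  have "(\<lambda>w. case_prod (g i) (f w, s w)) \<in> borel_measurable N"
    using assms(2,3) stochastic[OF assms(1)] unfolding stochastic_operator_def
    by (intro measurable_compose[OF measurable_Pair]) 
  then show ?thesis by simp
qed

text \<open>
  Measurability is tracked separately for each component \<open>i \<in> {1..n}\<close>: nothing is known about
  \<open>g i\<close> for other indices.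
\<close>

lemma measurable_fl_step:
  assumes x: "\<And>i. i \<in> {1..n} \<Longrightarrow> (\<lambda>w. fst (S w) i) \<in> borel_measurable N"
    and h: "\<And>i. i \<in> {1..n} \<Longrightarrow> (\<lambda>w. snd (S w) i) \<in> borel_measurable N"
    and q: "q \<in> N \<rightarrow>\<^sub>M Q"
    and i: "i \<in> {1..n}"
  shows "(\<lambda>w. fst (fl_step n \<gamma> p (\<lambda>i. g i (fst (S w) i) (snd (q w))) (fst (q w)) (S w)) i)
      \<in> borel_measurable N" (is ?x)
    and "(\<lambda>w. snd (fl_step n \<gamma> p (\<lambda>i. g i (fst (S w) i) (snd (q w))) (fst (q w)) (S w)) i)
      \<in> borel_measurable N" (is ?h)
proof -
  have b: "Measurable.pred N (\<lambda>w. fst (q w))"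
    using measurable_compose[OF q measurable_fst] by simp
  have s: "(\<lambda>w. snd (q w)) \<in> N \<rightarrow>\<^sub>M D"
    using measurable_compose[OF q measurable_snd] .
  have xhat: "(\<lambda>w. fst (S w) i - \<gamma> *\<^sub>R (g i (fst (S w) i) (snd (q w)) - snd (S w) i))
      \<in> borel_measurable N" if "i \<in> {1..n}" for i
    using that x h s
    by (intro borel_measurable_diff borel_measurable_scaleR borel_measurable_const measurable_operator)
  show x': ?x
    unfolding fl_step_def split_beta Let_def fst_conv
  proof (intro measurable_If xhat[OF i])
    show "(\<lambda>w. (1 / real n) *\<^sub>R (\<Sum>j=1..n. fst (S w) j
          - \<gamma> *\<^sub>R (g j (fst (S w) j) (snd (q w)) - snd (S w) j) - (\<gamma> / p) *\<^sub>R snd (S w) j))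
        \<in> borel_measurable N"
      by (rule borel_measurable_scaleR[OF borel_measurable_const borel_measurable_sum])
        (rule borel_measurable_diff[OF xhat borel_measurable_scaleR[OF borel_measurable_const h]])
  qed (use b in \<open>simp add: pred_def\<close>)
  have eq: "snd (fl_step n \<gamma> p G c S') i
      = snd S' i + (p / \<gamma>) *\<^sub>R (fst (fl_step n \<gamma> p G c S') i - (fst S' i - \<gamma> *\<^sub>R (G i - snd S' i)))"
    for G c S'
    by (simp add: fl_step_def Let_def split_beta)
  show ?h
    unfolding eq
    by (intro borel_measurable_add[OF h[OF i]] borel_measurable_scaleR borel_measurable_const
        borel_measurable_diff[OF x' xhat[OF i]])
qed

lemma measurable_V:
  assumes "\<And>i. i \<in> {1..n} \<Longrightarrow> (\<lambda>w. fst (S w) i) \<in> borel_measurable N"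
    and "\<And>i. i \<in> {1..n} \<Longrightarrow> (\<lambda>w. snd (S w) i) \<in> borel_measurable N"
  shows "(\<lambda>w. V (S w)) \<in> borel_measurable N"
  unfolding lyapunov_def split_beta using assms
  by (intro borel_measurable_add borel_measurable_times borel_measurable_const
      borel_measurable_sum borel_measurable_power
      measurable_compose[OF borel_measurable_diff borel_measurable_norm])

lemma run_Suc:
  "run x0 h0 (Suc k) w
    = fl_step n \<gamma> p (\<lambda>i. g i (fst (run x0 h0 k w) i) (snd (w k))) (fst (w k)) (run x0 h0 k w)"
  by (simp add: run_def proxskip_vip_fl_Suc_step)

lemma run_update: "run x0 h0 k (w(k := q)) = run x0 h0 k w"
  unfolding run_def by (rule proxskip_vip_fl_cong) auto

lemma measurable_run:
  assumes "{..<k} \<subseteq> J" and "i \<in> {1..n}"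
  shows "(\<lambda>w. fst (run x0 h0 k w) i) \<in> borel_measurable (Pi\<^sub>M J (\<lambda>_. Q))"
    and "(\<lambda>w. snd (run x0 h0 k w) i) \<in> borel_measurable (Pi\<^sub>M J (\<lambda>_. Q))"
  using assms
proof (induction k arbitrary: i)
  case 0
  { case 1 show ?case by (simp add: run_def) }
  { case 2 show ?case by (simp add: run_def) }
next
  case (Suc k)
  have sub: "{..<k} \<subseteq> J" if "{..<Suc k} \<subseteq> J" using that by auto
  have q: "(\<lambda>w. w k) \<in> Pi\<^sub>M J (\<lambda>_. Q) \<rightarrow>\<^sub>M Q" if "{..<Suc k} \<subseteq> J"
    using that by (intro measurable_component_singleton) auto
  { case 1 then show ?case
      unfolding run_Suc by (intro measurable_fl_step Suc.IH sub q) }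
  { case 2 then show ?case
      unfolding run_Suc by (intro measurable_fl_step Suc.IH sub q) }
qed

lemma measurable_V_run:
  "{..<k} \<subseteq> J \<Longrightarrow> (\<lambda>w. V (run x0 h0 k w)) \<in> borel_measurable (Pi\<^sub>M J (\<lambda>_. Q))"
  by (intro measurable_V measurable_run)

lemma p_sq_le_1: "p\<^sup>2 \<le> 1"
  using p by (simp add: power_le_one)

lemma noise_var_nonneg: "noise_var n D g H zs \<ge> 0"
  unfolding noise_var_def by (intro sum_nonneg integral_nonneg) auto

text \<open>
  The coin is summed out first, inside the integral over the sample: only the average over both
  outcomes is the sum of squares that a stochastic operator step controls.
\<close>

lemma expected_step:
  "(\<integral>\<^sup>+q. ennreal (V (fl_step n \<gamma> p (\<lambda>i. g i (fst S i) (snd q)) (fst q) S)) \<partial>Q)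
    \<le> ennreal ((1 - p\<^sup>2) * V S + 2 * \<gamma>\<^sup>2 * noise_var n D g H zs)"
proof -
  obtain x h where S: "S = (x, h)" by force
  define f where "f q = V (fl_step n \<gamma> p (\<lambda>i. g i (fst S i) (snd q)) (fst q) S)" for q
  have f_pos: "f q \<ge> 0" for q
    unfolding f_def by (rule lyapunov_nonneg)
  have f_meas: "f \<in> borel_measurable Q"
    unfolding f_def
    using measurable_fl_step[of "\<lambda>_. S" Q "\<lambda>q. q"] by (intro measurable_V) auto
  then have f_meas': "f \<in> borel_measurable (count_space UNIV \<Otimes>\<^sub>M D)"
    by (simp cong: measurable_cong_sets sets_pair_measure_cong)
  have f_sec: "(\<lambda>s. f (b, s)) \<in> borel_measurable D" for b
    by (rule measurable_compose[OF _ f_meas']) simp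
  define e where "e i s = (norm (x i - zs - \<gamma> *\<^sub>R (g i (x i) s - H i zs)))\<^sup>2" for i s
  define R where "R = (1 - p\<^sup>2) * (\<gamma>\<^sup>2 / p\<^sup>2 * (\<Sum>i=1..n. (norm (h i - H i zs))\<^sup>2))"
  have R: "R \<ge> 0"
    unfolding R_def using p_sq_le_1 by (intro mult_nonneg_nonneg sum_nonneg) auto
  have e_int: "integrable D (e i)"
    and e_le: "(\<integral>s. e i s \<partial>D) \<le> (1 - p\<^sup>2) * (norm (x i - zs))\<^sup>2
      + 2 * \<gamma>\<^sup>2 * (\<integral>s. (norm (g i zs s - H i zs))\<^sup>2 \<partial>D)" if "i \<in> {1..n}" for i
    using operator_step_contraction[OF prob_space_axioms unbiased cocoercive noise monotone \<gamma> \<mu>,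
        OF that that that that, of "x i"]
    unfolding e_def p_sq by simp_all
  have avg: "ennreal p * ennreal (f (True, s)) + ennreal (1 - p) * ennreal (f (False, s))
      = ennreal ((\<Sum>i=1..n. e i s) + R)" for s
  proof -
    have "ennreal p * ennreal (f (True, s)) + ennreal (1 - p) * ennreal (f (False, s))
        = ennreal (p * f (True, s) + (1 - p) * f (False, s))"
      using p f_pos by (simp add: ennreal_mult ennreal_plus)
    also have "p * f (True, s) + (1 - p) * f (False, s) = (\<Sum>i=1..n. e i s) + R"
      unfolding f_def S fst_conv snd_conv e_def R_def
      by (rule lyapunov_step_average[where G = "\<lambda>i. g i (x i) s"]) (use n \<gamma> p zero in auto)
    finally show ?thesis .
  qed
  have "(\<integral>\<^sup>+q. ennreal (f q) \<partial>Q) = (\<integral>\<^sup>+b. \<integral>\<^sup>+s. ennreal (f (b, s)) \<partial>D \<partial>measure_pmf (bernoulli_pmf p))"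
    using f_meas by (subst nn_integral_fst) auto
  also have "\<dots> = (\<integral>\<^sup>+s. ennreal (f (True, s)) \<partial>D) * ennreal p
      + (\<integral>\<^sup>+s. ennreal (f (False, s)) \<partial>D) * ennreal (1 - p)"
    using p by (subst nn_integral_bernoulli_pmf) auto
  also have "\<dots> = (\<integral>\<^sup>+s. ennreal p * ennreal (f (True, s)) + ennreal (1 - p) * ennreal (f (False, s)) \<partial>D)"
    using f_sec by (simp add: nn_integral_add nn_integral_cmult mult.commute)
  also have "\<dots> = (\<integral>\<^sup>+s. ennreal ((\<Sum>i=1..n. e i s) + R) \<partial>D)"
    unfolding avg ..
  also have "\<dots> = ennreal (\<integral>s. (\<Sum>i=1..n. e i s) + R \<partial>D)"
  proof (rule nn_integral_eq_integral)
    show "integrable D (\<lambda>s. (\<Sum>i=1..n. e i s) + R)"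
      using e_int by (intro Bochner_Integration.integrable_add Bochner_Integration.integrable_sum) simp_all
    show "AE s in D. 0 \<le> (\<Sum>i=1..n. e i s) + R"
      using R by (intro AE_I2 add_nonneg_nonneg sum_nonneg) (auto simp: e_def)
  qed
  also have "(\<integral>s. (\<Sum>i=1..n. e i s) + R \<partial>D) = (\<Sum>i=1..n. \<integral>s. e i s \<partial>D) + R"
    using e_int by (subst Bochner_Integration.integral_add)
      (auto simp: Bochner_Integration.integral_sum prob_space)
  also have "ennreal \<dots> \<le> ennreal ((1 - p\<^sup>2) * V S + 2 * \<gamma>\<^sup>2 * noise_var n D g H zs)"
  proof (rule ennreal_leI)
    have "(\<Sum>i=1..n. \<integral>s. e i s \<partial>D) \<le> (\<Sum>i=1..n. (1 - p\<^sup>2) * (norm (x i - zs))\<^sup>2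
        + 2 * \<gamma>\<^sup>2 * (\<integral>s. (norm (g i zs s - H i zs))\<^sup>2 \<partial>D))"
      by (rule sum_mono) (rule e_le)
    then show "(\<Sum>i=1..n. \<integral>s. e i s \<partial>D) + R \<le> (1 - p\<^sup>2) * V S + 2 * \<gamma>\<^sup>2 * noise_var n D g H zs"
      unfolding S R_def lyapunov_def noise_var_def
      by (simp add: sum.distrib sum_distrib_left distrib_left)
  qed
  finally show ?thesis
    unfolding f_def .
qed

text \<open>
  The bound interpolates between \<open>V (x0, h0)\<close> and the stationary level \<open>B\<close>, the fixed point of
  the recursion \<open>v \<mapsto> (1 - p\<^sup>2) v + 2 \<gamma>\<^sup>2 \<sigma>\<^sup>2\<close>. Keeping the factor \<open>1 - (1 - p\<^sup>2)\<^sup>k\<close> in front of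
  \<open>B\<close> makes the bound a convex combination, so it never exceeds the larger of the two values.
\<close>

lemma expected_V_product:
  defines "B \<equiv> 2 * \<gamma> * noise_var n D g H zs / \<mu>"
  shows "(\<integral>\<^sup>+w. ennreal (V (run x0 h0 k w)) \<partial>Pi\<^sub>M {..<k} (\<lambda>_. Q))
    \<le> ennreal ((1 - p\<^sup>2) ^ k * V (x0, h0) + (1 - (1 - p\<^sup>2) ^ k) * B)"
proof (induction k)
  case 0
  interpret Q: pair_prob_space "measure_pmf (bernoulli_pmf p)" D ..
  interpret P: prob_space "Pi\<^sub>M {} (\<lambda>_::nat. Q)"
    by (intro prob_space_PiM Q.prob_space_axioms)
  show ?case
    by (simp add: run_def P.emeasure_space_1)
next
  case (Suc k)
  interpret Q: pair_prob_space "measure_pmf (bernoulli_pmf p)" D ..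
  interpret PQ: product_prob_space "\<lambda>_::nat. Q" UNIV ..
  interpret P: prob_space "Pi\<^sub>M {..<k} (\<lambda>_. Q)"
    by (intro prob_space_PiM Q.prob_space_axioms)
  let ?c = "2 * \<gamma>\<^sup>2 * noise_var n D g H zs"
  let ?U = "(1 - p\<^sup>2) ^ k * V (x0, h0) + (1 - (1 - p\<^sup>2) ^ k) * B"
  have c: "?c \<ge> 0"
    by (simp add: noise_var_nonneg)
  have U: "?U \<ge> 0"
    using p_sq_le_1 lyapunov_nonneg[of n \<gamma> p H zs "(x0, h0)"] noise_var_nonneg \<gamma> \<mu>
    by (intro add_nonneg_nonneg mult_nonneg_nonneg) (auto simp: B_def power_le_one)
  have ennreal_affine: "ennreal ((1 - p\<^sup>2) * v + b) = ennreal (1 - p\<^sup>2) * ennreal v + ennreal b"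
    if "v \<ge> 0" "b \<ge> 0" for v b
    using that p_sq_le_1 by (subst ennreal_plus) (simp_all add: ennreal_mult)
  have c_eq: "?c = p\<^sup>2 * B"
    unfolding p_sq using \<mu> by (simp add: B_def power2_eq_square)
  have "(\<integral>\<^sup>+w. ennreal (V (run x0 h0 (Suc k) w)) \<partial>Pi\<^sub>M {..<Suc k} (\<lambda>_. Q))
      = (\<integral>\<^sup>+w. \<integral>\<^sup>+q. ennreal (V (run x0 h0 (Suc k) (w(k := q)))) \<partial>Q \<partial>Pi\<^sub>M {..<k} (\<lambda>_. Q))"
    unfolding lessThan_Suc
    by (intro PQ.product_nn_integral_insert measurable_compose[OF _ measurable_ennreal] measurable_V_run)
      auto
  also have "\<dots> \<le> (\<integral>\<^sup>+w. ennreal ((1 - p\<^sup>2) * V (run x0 h0 k w) + ?c) \<partial>Pi\<^sub>M {..<k} (\<lambda>_. Q))"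
    unfolding run_Suc run_update fun_upd_same
    by (intro nn_integral_mono expected_step)
  also have "\<dots> = (\<integral>\<^sup>+w. ennreal (1 - p\<^sup>2) * ennreal (V (run x0 h0 k w)) + ennreal ?c \<partial>Pi\<^sub>M {..<k} (\<lambda>_. Q))"
    by (simp only: ennreal_affine[OF lyapunov_nonneg c])
  also have "\<dots> = ennreal (1 - p\<^sup>2) * (\<integral>\<^sup>+w. ennreal (V (run x0 h0 k w)) \<partial>Pi\<^sub>M {..<k} (\<lambda>_. Q)) + ennreal ?c"
    using measurable_V_run[of k "{..<k}" x0 h0]
    by (simp add: nn_integral_add nn_integral_cmult P.emeasure_space_1)
  also have "\<dots> \<le> ennreal (1 - p\<^sup>2) * ennreal ?U + ennreal ?c"
    by (intro add_mono mult_left_mono Suc.IH) auto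
  also have "\<dots> = ennreal ((1 - p\<^sup>2) * ?U + ?c)"
    by (simp only: ennreal_affine[OF U c])
  also have "(1 - p\<^sup>2) * ?U + ?c
      = (1 - p\<^sup>2) ^ Suc k * V (x0, h0) + (1 - (1 - p\<^sup>2) ^ Suc k) * B"
    unfolding c_eq by (simp add: algebra_simps)
  finally show ?case .
qed

text \<open>
  Independence and identical distribution say precisely that the first \<open>k\<close> pairs are distributed
  as \<open>Pi\<^sub>M {..<k} (\<lambda>_. Q)\<close>, to which the bound on the product space applies.
\<close>

lemma expected_V:
  fixes M :: "'w measure" and x0 h0 :: "nat \<Rightarrow> real ^ 'd"
  assumes rand: "proxskip_randomness M p D \<theta> \<xi>"
  defines "W \<equiv> \<lambda>k \<omega>. V (proxskip_vip_fl n \<gamma> p g x0 h0 (\<lambda>j. \<theta> j \<omega>) (\<lambda>j. \<xi> j \<omega>) k)"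
    and "B \<equiv> 2 * \<gamma> * noise_var n D g H zs / \<mu>"
  shows "integrable M (W k)" (is ?int)
    and "(\<integral>\<omega>. W k \<omega> \<partial>M) \<le> (1 - p\<^sup>2) ^ k * V (x0, h0) + (1 - (1 - p\<^sup>2) ^ k) * B" (is ?le)
proof -
  interpret M: prob_space M
    using rand by (simp add: proxskip_randomness_def)
  let ?N = "count_space (UNIV :: bool set) \<Otimes>\<^sub>M D"
  define X where "X k \<omega> = (\<theta> k \<omega>, \<xi> k \<omega>)" for k \<omega>
  have indep: "M.indep_vars (\<lambda>_. ?N) X UNIV" and law: "distr M ?N (X k) = Q" for k
    using rand by (auto simp: proxskip_randomness_def X_def[abs_def])
  have rv: "X k \<in> M \<rightarrow>\<^sub>M ?N" for k
    using indep unfolding M.indep_vars_def by auto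
  have sets_Q: "sets Q = sets ?N"
    by (intro sets_pair_measure_cong) auto
  let ?P = "\<lambda>k. Pi\<^sub>M {..<k} (\<lambda>_. Q)"
  define past where "past k \<omega> = restrict (\<lambda>j. X j \<omega>) {..<k}" for k \<omega>
  have past: "past k \<in> M \<rightarrow>\<^sub>M ?P k" for k
    unfolding past_def
    by (intro measurable_restrict) (use rv sets_Q in \<open>simp cong: measurable_cong_sets\<close>)
  have W: "W k \<omega> = V (run x0 h0 k (past k \<omega>))" for k \<omega>
    unfolding W_def run_def past_def X_def by (intro arg_cong[of _ _ V] proxskip_vip_fl_cong) auto
  have W_pos: "W k \<omega> \<ge> 0" for k \<omega>
    unfolding W_def by (rule lyapunov_nonneg)
  have W_meas: "W k \<in> borel_measurable M"
    unfolding W[abs_def] by (rule measurable_compose[OF past measurable_V_run]) simp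
  let ?U = "(1 - p\<^sup>2) ^ k * V (x0, h0) + (1 - (1 - p\<^sup>2) ^ k) * B"
  have U: "?U \<ge> 0"
    using p_sq_le_1 lyapunov_nonneg[of n \<gamma> p H zs "(x0, h0)"] noise_var_nonneg \<gamma> \<mu>
    by (intro add_nonneg_nonneg mult_nonneg_nonneg) (auto simp: B_def power_le_one)
  have "(\<integral>\<^sup>+\<omega>. ennreal (W k \<omega>) \<partial>M) \<le> ennreal ?U"
    \<comment> \<open>The characterisation of independence by product laws needs a nonempty index set.\<close>
  proof (cases "k = 0")
    case True
    then show ?thesis by (simp add: W_def M.emeasure_space_1)
  next
    case False
    have "M.indep_vars (\<lambda>_. ?N) X {..<k}"
      by (rule M.indep_vars_subset[OF indep]) simp
    then have "distr M (Pi\<^sub>M {..<k} (\<lambda>_. ?N)) (past k) = ?P k"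
      using False M.indep_vars_iff_distr_eq_PiM'[where I = "{..<k}" and M' = "\<lambda>_. ?N" and X = X] rv
      by (simp add: law past_def[abs_def] lessThan_empty_iff)
    also have "distr M (Pi\<^sub>M {..<k} (\<lambda>_. ?N)) (past k) = distr M (?P k) (past k)"
      by (intro distr_cong sets_PiM_cong) (auto simp: sets_Q)
    finally have distr: "distr M (?P k) (past k) = ?P k" .
    have "(\<integral>\<^sup>+\<omega>. ennreal (W k \<omega>) \<partial>M)
        = (\<integral>\<^sup>+w. ennreal (V (run x0 h0 k w)) \<partial>distr M (?P k) (past k))"
      unfolding W using measurable_V_run[of k "{..<k}" x0 h0] past
      by (subst nn_integral_distr) auto
    also have "\<dots> \<le> ennreal ?U"
      unfolding distr B_def by (rule expected_V_product)
    finally show ?thesis .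
  qed
  then show ?int
    using W_meas W_pos
    by (intro integrableI_bounded) (auto simp: ennreal_less_top order_le_less_trans)
  have "ennreal (\<integral>\<omega>. W k \<omega> \<partial>M) = (\<integral>\<^sup>+\<omega>. ennreal (W k \<omega>) \<partial>M)"
    using \<open>?int\<close> W_pos by (intro nn_integral_eq_integral[symmetric]) auto
  also have "\<dots> \<le> ennreal ?U" by fact
  finally show ?le
    using U by (simp add: ennreal_le_iff)
qed

end

section \<open>Number of communication rounds\<close>

lemma expected_comm_rounds:
  assumes rand: "proxskip_randomness M p D \<theta> \<xi>" and D: "prob_space D" and p: "0 \<le> p" "p \<le> 1"
  shows "(\<integral>\<omega>. real (comm_rounds (\<lambda>k. \<theta> k \<omega>) K) \<partial>M) = p * real K"
proof -
  interpret M: prob_space M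
    using rand by (simp add: proxskip_randomness_def)
  interpret D: prob_space D by (rule D)
  let ?N = "count_space (UNIV :: bool set) \<Otimes>\<^sub>M D"
  have rv: "(\<lambda>\<omega>. (\<theta> k \<omega>, \<xi> k \<omega>)) \<in> M \<rightarrow>\<^sub>M ?N"
    and law: "distr M ?N (\<lambda>\<omega>. (\<theta> k \<omega>, \<xi> k \<omega>)) = measure_pmf (bernoulli_pmf p) \<Otimes>\<^sub>M D" for k
    using rand unfolding proxskip_randomness_def M.indep_vars_def by auto
  have coin: "\<theta> k \<in> M \<rightarrow>\<^sub>M count_space UNIV" for k
    using measurable_compose[OF rv measurable_fst] by simp
  have prob: "M.prob {\<omega> \<in> space M. \<theta> k \<omega>} = p" for k
  proof -
    have "emeasure M {\<omega> \<in> space M. \<theta> k \<omega>} = emeasure (distr M ?N (\<lambda>\<omega>. (\<theta> k \<omega>, \<xi> k \<omega>))) ({True} \<times> space D)"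
      using rv[of k] by (subst emeasure_distr)
        (auto intro!: arg_cong2[where f = emeasure] dest: measurable_space simp: space_pair_measure)
    also have "\<dots> = emeasure (measure_pmf (bernoulli_pmf p)) {True} * emeasure D (space D)"
      unfolding law by (rule D.emeasure_pair_measure_Times) auto
    also have "\<dots> = ennreal p"
      using p by (simp add: D.emeasure_space_1 emeasure_pmf_single)
    finally show ?thesis
      using p by (simp add: M.emeasure_eq_measure)
  qed
  have "real (comm_rounds (\<lambda>k. \<theta> k \<omega>) K) = (\<Sum>k<K. indicator {\<omega> \<in> space M. \<theta> k \<omega>} \<omega>)"
    if "\<omega> \<in> space M" for \<omega>
  proof -
    have "{k. k < K \<and> \<theta> k \<omega>} = {..<K} \<inter> {k. \<theta> k \<omega>}" by auto
    then have "real (comm_rounds (\<lambda>k. \<theta> k \<omega>) K) = (\<Sum>k\<in>{..<K} \<inter> {k. \<theta> k \<omega>}. 1 :: real)"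
      by (simp add: comm_rounds_def)
    also have "\<dots> = (\<Sum>k<K. if k \<in> {k. \<theta> k \<omega>} then 1 else 0)"
      by (rule sum.inter_restrict) simp
    finally show ?thesis
      using that by (simp only: indicator_def of_bool_def mem_Collect_eq simp_thms)
  qed
  then have "(\<integral>\<omega>. real (comm_rounds (\<lambda>k. \<theta> k \<omega>) K) \<partial>M)
      = (\<integral>\<omega>. (\<Sum>k<K. indicator {\<omega> \<in> space M. \<theta> k \<omega>} \<omega>) \<partial>M)"
    by (intro Bochner_Integration.integral_cong) auto
  also have "\<dots> = (\<Sum>k<K. M.prob {\<omega> \<in> space M. \<theta> k \<omega>})"
    using coin by (subst Bochner_Integration.integral_sum)
      (auto intro!: integrable_real_indicator simp: M.emeasure_eq_measure pred_def[symmetric] less_top[symmetric])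
  finally show ?thesis
    by (simp add: prob)
qed

section \<open>Choice of the parameters\<close>

text \<open>
  Rounding down a number below \<open>1\<close> gives \<open>0\<close> iterations, which suffices only if the start is
  good enough. If \<open>V0 \<le> \<epsilon>\<close>, every \<open>k\<close> will do, since the bound is a convex combination of \<open>V0\<close>
  and \<open>B\<close>. If \<open>V0 > \<epsilon>\<close>, the logarithm exceeds \<open>ln 2 \<ge> 1/2\<close>, so \<open>8 m ln (2 V0 / \<epsilon>) \<ge> 4\<close>, and
  rounding it down leaves at least the half that is needed for the decay.
\<close>

lemma geometric_decay_after_log_iterations:
  fixes m V0 \<epsilon> :: real
  assumes m: "m \<ge> 1" and V0: "V0 \<ge> 0" and \<epsilon>: "\<epsilon> > 0" and B: "B \<le> \<epsilon> / 2"
    and K: "K = nat \<lfloor>8 * m * log_factor V0 \<epsilon>\<rfloor>" and k: "K \<le> k"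
  defines "r \<equiv> 1 - 1 / (4 * m)"
  shows "real K \<le> 8 * m * log_factor V0 \<epsilon>" and "r ^ k * V0 + (1 - r ^ k) * B \<le> \<epsilon>"
proof -
  let ?a = "m * log_factor V0 \<epsilon>"
  have a: "?a \<ge> 0"
    using m by (simp add: log_factor_def)
  show "real K \<le> 8 * m * log_factor V0 \<epsilon>"
    unfolding K using a by simp
  have r: "0 \<le> r" "r \<le> 1"
    using m by (simp_all add: r_def divide_simps)
  have rk: "0 \<le> r ^ k" "r ^ k \<le> 1"
    using r by (simp_all add: power_le_one)
  have rest: "(1 - r ^ k) * B \<le> (1 - r ^ k) * (\<epsilon> / 2)"
    using B rk by (intro mult_left_mono) auto
  show "r ^ k * V0 + (1 - r ^ k) * B \<le> \<epsilon>"
  proof (cases "V0 \<le> \<epsilon>")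
    case True
    have "r ^ k * V0 + (1 - r ^ k) * B \<le> r ^ k * \<epsilon> + (1 - r ^ k) * \<epsilon>"
      using True rk \<epsilon> B by (intro add_mono mult_left_mono) auto
    then show ?thesis by (simp add: algebra_simps)
  next
    case False
    let ?l = "ln (2 * V0 / \<epsilon>)"
    have pos: "2 * V0 / \<epsilon> > 0"
      using False \<epsilon> by simp
    have "exp (1 / 2) \<le> 2 * V0 / \<epsilon>"
      using False \<epsilon> exp_half_le2 by (intro order_trans[OF exp_half_le2]) (simp add: field_simps)
    then have l: "?l \<ge> 1 / 2"
      by (simp only: ln_ge_iff[OF pos])
    then have lf: "log_factor V0 \<epsilon> = ?l"
      by (simp add: log_factor_def)
    have "1 * (1 / 2) \<le> m * ?l"
      using m l by (intro mult_mono) auto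
    moreover have "8 * m * ?l < real K + 1"
      unfolding K lf by linarith
    ultimately have "4 * m * ?l \<le> real K"
      by linarith
    also have "\<dots> \<le> real k"
      using k by simp
    finally have k_ge: "?l \<le> real k / (4 * m)"
      using m by (simp add: field_simps)
    have "r \<le> exp (- (1 / (4 * m)))"
      using exp_ge_add_one_self[of "- (1 / (4 * m))"] by (simp add: r_def)
    then have "r ^ k \<le> exp (- (1 / (4 * m))) ^ k"
      using r by (intro power_mono) auto
    also have "\<dots> = exp (- (real k / (4 * m)))"
      by (simp only: exp_of_nat_mult[symmetric]) simp
    also have "\<dots> \<le> exp (- ?l)"
      using k_ge by simp
    also have "\<dots> = \<epsilon> / (2 * V0)"
      by (simp only: exp_minus exp_ln[OF pos] inverse_divide)
    finally have "r ^ k * V0 \<le> \<epsilon> / (2 * V0) * V0"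
      using V0 by (intro mult_right_mono)
    also have "\<dots> = \<epsilon> / 2"
      using False \<epsilon> by simp
    finally have "r ^ k * V0 \<le> \<epsilon> / 2" .
    moreover have "(1 - r ^ k) * (\<epsilon> / 2) \<le> 1 * (\<epsilon> / 2)"
      using rk \<epsilon> by (intro mult_right_mono) auto
    ultimately show ?thesis
      using rest by simp
  qed
qed

text \<open>The test point \<open>zs - F zs\<close> turns the inequality into \<open>- \<parallel>F zs\<parallel>\<^sup>2 \<ge> 0\<close>.\<close>

lemma VI_solution_iff_zero: "VI_solution F zs \<longleftrightarrow> F zs = 0"
proof
  assume "VI_solution F zs"
  then have "F zs \<bullet> (zs - F zs - zs) \<ge> 0"
    unfolding VI_solution_def by blast
  then have "F zs \<bullet> F zs \<le> 0"
    by (simp add: inner_diff_right)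
  then show "F zs = 0"
    by (metis inner_gt_zero_iff linorder_not_less)
qed (simp add: VI_solution_def)

theorem theorem5p2:
  fixes n :: nat
    and H :: "nat \<Rightarrow> real ^ 'd \<Rightarrow> real ^ 'd"
    and g :: "nat \<Rightarrow> real ^ 'd \<Rightarrow> 's \<Rightarrow> real ^ 'd"
    and D :: "'s measure"
    and zs :: "real ^ 'd"
    and \<mu> L \<epsilon> :: real
  assumes "n \<ge> 1"
    and "prob_space D"
    and "VI_solution (mean_operator n H) zs"
    and "\<And>z. VI_solution (mean_operator n H) z \<Longrightarrow> z = zs"
    and "\<mu> > 0"
    and "\<And>i. i \<in> {1..n} \<Longrightarrow> quasi_strongly_monotone (H i) zs \<mu>"
    and "\<And>i. i \<in> {1..n} \<Longrightarrow> stochastic_operator D (g i)"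
    and "\<And>i. i \<in> {1..n} \<Longrightarrow> unbiased_estimator D (g i) (H i)"
    and "\<And>i. i \<in> {1..n} \<Longrightarrow> expected_cocoercive D (g i) (H i) zs L"
    and "\<And>i. i \<in> {1..n} \<Longrightarrow> finite_noise D (g i) (H i) zs"
    and "\<epsilon> > 0"
  shows "\<exists>\<gamma> p. \<gamma> > 0 \<and> 0 < p \<and> p \<le> 1 \<and>
    (\<forall>x0 h0. \<exists>K.
      real K \<le> abs_const * max (L / \<mu>) (noise_var n D g H zs / (\<mu>\<^sup>2 * \<epsilon>))
                 * log_factor (lyapunov n \<gamma> p H zs (x0, h0)) \<epsilon> \<and>
      p * real K \<le> abs_const * sqrt (max (L / \<mu>) (noise_var n D g H zs / (\<mu>\<^sup>2 * \<epsilon>)))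
                 * log_factor (lyapunov n \<gamma> p H zs (x0, h0)) \<epsilon> \<and>
      (\<forall>(M :: 'w measure) \<theta> \<xi>. proxskip_randomness M p D \<theta> \<xi> \<longrightarrow>
         (\<integral>\<omega>. real (comm_rounds (\<lambda>k. \<theta> k \<omega>) K) \<partial>M) = p * real K \<and>
         (\<forall>k\<ge>K.
            let V = (\<lambda>\<omega>. lyapunov n \<gamma> p H zs
                            (proxskip_vip_fl n \<gamma> p g x0 h0 (\<lambda>j. \<theta> j \<omega>) (\<lambda>j. \<xi> j \<omega>) k))
            in integrable M V \<and> (\<integral>\<omega>. V \<omega> \<partial>M) \<le> \<epsilon>)))"
proof -
  note n = assms(1) and D = assms(2) and \<mu> = assms(5) and \<epsilon> = assms(11)
  define \<sigma>2 where "\<sigma>2 = noise_var n D g H zs"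
  define m where "m = max (L / \<mu>) (\<sigma>2 / (\<mu>\<^sup>2 * \<epsilon>))"
  define \<gamma> where "\<gamma> = 1 / (4 * \<mu> * m)"
  define p where "p = 1 / (2 * sqrt m)"
  have "\<mu> \<le> L"
    by (rule strong_monotonicity_le_cocoercivity[OF D assms(8,9,6)[of 1] \<mu>]) (use n in auto)
  then have m1: "m \<ge> 1"
    unfolding m_def using \<mu> by (simp add: le_max_iff_disj)
  have m_L: "L \<le> \<mu> * m"
    using \<mu> max.cobounded1[of "L / \<mu>" "\<sigma>2 / (\<mu>\<^sup>2 * \<epsilon>)"] unfolding m_def[symmetric] by (simp add: field_simps)
  have m_\<sigma>: "\<sigma>2 \<le> \<mu>\<^sup>2 * \<epsilon> * m"
    using \<mu> \<epsilon> max.cobounded2[of "\<sigma>2 / (\<mu>\<^sup>2 * \<epsilon>)" "L / \<mu>"] unfolding m_def[symmetric] by (simp add: field_simps)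
  have \<gamma>: "\<gamma> > 0"
    using \<mu> m1 by (simp add: \<gamma>_def)
  have "1 \<le> 2 * sqrt m"
    using real_sqrt_ge_one[OF m1] by linarith
  then have p: "0 < p" "p \<le> 1"
    using m1 by (simp_all add: p_def)
  have p_\<gamma>: "p\<^sup>2 = \<gamma> * \<mu>" and p_m: "p\<^sup>2 = 1 / (4 * m)"
    using \<mu> m1 by (simp_all add: p_def \<gamma>_def power_divide power_mult_distrib)
  have \<gamma>L: "\<gamma> * L \<le> 1 / 2"
  proof -
    have "\<mu> * m > 0"
      using \<mu> m1 by simp
    with m_L have "L \<le> 2 * (\<mu> * m)" by linarith
    then show ?thesis
      using \<mu> m1 by (simp add: \<gamma>_def divide_simps)
  qed
  have zero: "(\<Sum>i=1..n. H i zs) = 0"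
    using assms(3) n by (simp add: VI_solution_iff_zero mean_operator_def)
  have B: "2 * \<gamma> * \<sigma>2 / \<mu> \<le> \<epsilon> / 2"
    using m_\<sigma> \<mu> m1 by (simp add: \<gamma>_def divide_simps power2_eq_square algebra_simps)
  interpret proxskip_setting D n H g zs \<mu> L \<gamma> p
    by (intro proxskip_setting.intro proxskip_setting_axioms.intro)
      (fact n D \<mu> assms(6-10) zero \<gamma> \<gamma>L p p_\<gamma>)+
  have p_sqrt: "p * m = sqrt m / 2"
    using m1 by (simp add: p_def real_div_sqrt)
  have main: "\<exists>K. real K \<le> abs_const * m * log_factor (V (x0, h0)) \<epsilon> \<and>
      p * real K \<le> abs_const * sqrt m * log_factor (V (x0, h0)) \<epsilon> \<and>
      (\<forall>(M :: 'w measure) \<theta> \<xi>. proxskip_randomness M p D \<theta> \<xi> \<longrightarrow>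
         (\<integral>\<omega>. real (comm_rounds (\<lambda>k. \<theta> k \<omega>) K) \<partial>M) = p * real K \<and>
         (\<forall>k\<ge>K. let W = (\<lambda>\<omega>. V (proxskip_vip_fl n \<gamma> p g x0 h0 (\<lambda>j. \<theta> j \<omega>) (\<lambda>j. \<xi> j \<omega>) k))
            in integrable M W \<and> (\<integral>\<omega>. W \<omega> \<partial>M) \<le> \<epsilon>))" for x0 h0
  proof -
    let ?l = "log_factor (V (x0, h0)) \<epsilon>"
    define K where "K = nat \<lfloor>8 * m * ?l\<rfloor>"
    note count = geometric_decay_after_log_iterations[OF m1 lyapunov_nonneg \<epsilon> B K_def]
    have l: "?l \<ge> 0"
      by (simp add: log_factor_def)
    have K: "real K \<le> 8 * m * ?l"
      by (rule count(1)[OF order_refl])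
    have "p * real K \<le> p * (8 * m * ?l)"
      using K p by (intro mult_left_mono) auto
    also have "\<dots> = 4 * sqrt m * ?l"
      using p_sqrt by (simp add: algebra_simps)
    also have "\<dots> \<le> 8 * sqrt m * ?l"
      using l m1 by (intro mult_right_mono) auto
    finally have pK: "p * real K \<le> 8 * sqrt m * ?l" .
    have rounds: "(\<integral>\<omega>. real (comm_rounds (\<lambda>k. \<theta> k \<omega>) K) \<partial>M) = p * real K"
      if "proxskip_randomness M p D \<theta> \<xi>" for M :: "'w measure" and \<theta> \<xi>
      using that D p by (intro expected_comm_rounds) auto
    have accuracy: "(\<integral>\<omega>. V (proxskip_vip_fl n \<gamma> p g x0 h0 (\<lambda>j. \<theta> j \<omega>) (\<lambda>j. \<xi> j \<omega>) k) \<partial>M) \<le> \<epsilon>"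
      if "proxskip_randomness M p D \<theta> \<xi>" and "K \<le> k" for M :: "'w measure" and \<theta> \<xi> k
    proof -
      have "(1 - p\<^sup>2) ^ k * V (x0, h0)
          + (1 - (1 - p\<^sup>2) ^ k) * (2 * \<gamma> * noise_var n D g H zs / \<mu>) \<le> \<epsilon>"
        using count(2)[OF that(2)] by (simp only: p_m \<sigma>2_def)
      then show ?thesis
        by (rule order_trans[OF expected_V(2)[OF that(1)]])
    qed
    show ?thesis
      unfolding abs_const_def Let_def
      by (intro exI[of _ K] conjI allI impI K pK rounds accuracy expected_V(1))
  qed
  show ?thesis
    unfolding \<sigma>2_def[symmetric] m_def[symmetric]
    by (rule exI[of _ \<gamma>], rule exI[of _ p], intro conjI allI \<gamma> p main)
qed

end
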